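(* Let $X$ be an Archimedean vector lattice. The following are equivalent: (i) $X$ has the countable supremum property; (ii) $\mathrm{uo}=\mathrm{u}\sigma\mathrm{o}$ on $X$; (iii) $\mathrm{uo}$ is Fréchet–Urysohn on $X$; (iv) $\mathrm{uo}$ is sequential on $X$.
   Context: Nets are indexed by pre-ordered upward directed sets. Order convergence on $X$: $x_\alpha\xrightarrow{\mathrm{o}}x$ if there is a set $D$ with $\bigwedge D=0$ such that for every $d\in D$ there is $\alpha_d$ with $|x_\alpha-x|\le d$ for all $\alpha\ge\alpha_d$. $\sigma$-order convergence $\sigma\mathrm{o}$: the same with $D$ replaced by a sequence $(u_n)$ in $X_+$ with $\bigwedge_n u_n=0$. Their unbounded modifications $\mathrm{uo}$ and $\mathrm{u}\sigma\mathrm{o}$: $x_\alpha\xrightarrow{\mathrm{uo}}x$ (resp. $\mathrm{u}\sigma\mathrm{o}$) if $y\wedge|x-x_\alpha|\to0$ in order (resp. in $\sigma$-order) for every $y\in X_+$. A convergence is Fréchet–Urysohn if for every $x$, the range of every net $(x_\alpha)$ converging to $x$ contains a sequence $(x_{\alpha_n})$ converging to $x$. It is sequential if every sequentially closed set (a set containing the limits of its convergent sequences) is closed (contains the limits of its convergent nets). $X$ has the countable supremum property if every $A\subseteq X$ with $\bigwedge A=0$ contains a countable $B\subseteq A$ with $\bigwedge B=0$. *)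

theory Defs
  imports
    Complex_Main
    "HOL-Library.Lattice_Algebras"
    "HOL-Library.Lub_Glb"
    "HOL-Library.Countable_Set"
    "HOL-Library.Equipollence"
begin

text \<open>The class \<^class>\<open>lattice_ab_group_add_abs\<close> fixes the modulus as
  \<open>\<bar>x\<bar> = sup x (- x)\<close>, so it adds no structure to that of a vector lattice.\<close>

class vector_lattice = ordered_real_vector + lattice_ab_group_add_abs

class archimedean_vector_lattice = vector_lattice +
  assumes archimedean: "(\<And>n::nat. of_nat n *\<^sub>R x \<le> y) \<Longrightarrow> x \<le> 0"

text \<open>Infima in \<open>X\<close> are written with the library relation \<^const>\<open>isGlb\<close>: \<open>isGlb UNIV D 0\<close>
  says that the infimum of \<open>D\<close> exists in \<open>X\<close> and equals \<open>0\<close> (in particular \<open>D\<close> consists of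
  positive elements).\<close>

definition countable_sup_property :: "'a::vector_lattice itself \<Rightarrow> bool" where
  "countable_sup_property _ \<longleftrightarrow>
     (\<forall>A::'a set. isGlb UNIV A 0 \<longrightarrow> (\<exists>B\<subseteq>A. countable B \<and> isGlb UNIV B 0))"

text \<open>A net is a function \<open>x\<close> on a nonempty index set \<open>I\<close> with a preorder \<open>r\<close>, where
  \<open>(\<alpha>, \<beta>) \<in> r\<close> means \<open>\<alpha> \<le> \<beta>\<close>. Values of \<open>x\<close> outside \<open>I\<close> are irrelevant.
  A convergence relates such nets to their limits. HOL cannot quantify over types inside a formula,
  so a convergence on nets with index sets in a type \<open>'i\<close> is an object depending on \<open>'i\<close>.\<close>

definition directed_preorder_on :: "'i set \<Rightarrow> 'i rel \<Rightarrow> bool" where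
  "directed_preorder_on I r \<longleftrightarrow> I \<noteq> {} \<and> preorder_on I r \<and>
     (\<forall>\<alpha>\<in>I. \<forall>\<beta>\<in>I. \<exists>\<gamma>\<in>I. (\<alpha>, \<gamma>) \<in> r \<and> (\<beta>, \<gamma>) \<in> r)"

type_synonym ('i, 'a) convergence = "'i set \<Rightarrow> 'i rel \<Rightarrow> ('i \<Rightarrow> 'a) \<Rightarrow> 'a \<Rightarrow> bool"

definition o_conv :: "('i, 'a::vector_lattice) convergence" where
  "o_conv I r x l \<longleftrightarrow> directed_preorder_on I r \<and>
     (\<exists>D. isGlb UNIV D 0 \<and>
        (\<forall>d\<in>D. \<exists>\<alpha>\<^sub>d\<in>I. \<forall>\<alpha>\<in>I. (\<alpha>\<^sub>d, \<alpha>) \<in> r \<longrightarrow> \<bar>x \<alpha> - l\<bar> \<le> d))"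

definition \<sigma>o_conv :: "('i, 'a::vector_lattice) convergence" where
  "\<sigma>o_conv I r x l \<longleftrightarrow> directed_preorder_on I r \<and>
     (\<exists>u::nat \<Rightarrow> 'a. (\<forall>n. 0 \<le> u n) \<and> isGlb UNIV (range u) 0 \<and>
        (\<forall>n. \<exists>\<alpha>\<^sub>n\<in>I. \<forall>\<alpha>\<in>I. (\<alpha>\<^sub>n, \<alpha>) \<in> r \<longrightarrow> \<bar>x \<alpha> - l\<bar> \<le> u n))"

definition unbounded ::
    "('i, 'a::vector_lattice) convergence \<Rightarrow> ('i, 'a) convergence" where
  "unbounded conv I r x l \<longleftrightarrow> (\<forall>y\<ge>0. conv I r (\<lambda>\<alpha>. inf y \<bar>l - x \<alpha>\<bar>) 0)"

definition uo_conv :: "('i, 'a::vector_lattice) convergence" where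
  "uo_conv = unbounded o_conv"

definition u\<sigma>o_conv :: "('i, 'a::vector_lattice) convergence" where
  "u\<sigma>o_conv = unbounded \<sigma>o_conv"

text \<open>The next definitions take two instances of one convergence: \<open>conv\<close> for nets with index sets
  in \<open>'i\<close>, and \<open>conv_seq\<close> for nets over \<open>nat\<close>, which is only applied to sequences, that is, to the
  index set \<open>UNIV\<close> with its usual order \<^const>\<open>natLeq\<close>.\<close>

definition frechet_urysohn ::
    "('i, 'a) convergence \<Rightarrow> (nat, 'a) convergence \<Rightarrow> bool" where
  "frechet_urysohn conv conv_seq \<longleftrightarrow>
     (\<forall>I r x l. directed_preorder_on I r \<and> conv I r x l \<longrightarrow>
        (\<exists>\<alpha>::nat \<Rightarrow> 'i. range \<alpha> \<subseteq> I \<and> conv_seq UNIV natLeq (\<lambda>n. x (\<alpha> n)) l))"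

definition closed_under :: "('i, 'a) convergence \<Rightarrow> 'a set \<Rightarrow> bool" where
  "closed_under conv C \<longleftrightarrow>
     (\<forall>I r x l. directed_preorder_on I r \<and> x ` I \<subseteq> C \<and> conv I r x l \<longrightarrow> l \<in> C)"

definition sequentially_closed_under :: "(nat, 'a) convergence \<Rightarrow> 'a set \<Rightarrow> bool" where
  "sequentially_closed_under conv_seq C \<longleftrightarrow>
     (\<forall>s l. range s \<subseteq> C \<and> conv_seq UNIV natLeq s l \<longrightarrow> l \<in> C)"

definition sequential_convergence ::
    "('i, 'a) convergence \<Rightarrow> (nat, 'a) convergence \<Rightarrow> bool" where
  "sequential_convergence conv conv_seq \<longleftrightarrow>
     (\<forall>C. sequentially_closed_under conv_seq C \<longrightarrow> closed_under conv C)"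

end

theory Submission
  imports Defs
begin

text \<open>
  With the countable supremum property order convergence is \<open>\<sigma>\<close>-order convergence. For the
  Frechet--Urysohn property let \<open>z\<^sub>\<alpha> = \<bar>l - x\<^sub>\<alpha>\<bar>\<close> and choose indices \<open>\<alpha>\<^sub>n\<close> successively so that
  \<open>z\<^bsub>\<alpha>\<^sub>n\<^esub>\<close> gets small when cut at any multiple \<open>j z\<^bsub>\<alpha>\<^sub>k\<^esub>\<close> of an earlier term. An element lying below all
  eventual upper bounds of \<open>y \<and> z\<^bsub>\<alpha>\<^sub>n\<^esub>\<close> is then disjoint from every \<open>z\<^bsub>\<alpha>\<^sub>k\<^esub>\<close>, and therefore zero.

  For the converses, the finite infima of a set \<open>A\<close> with \<open>\<And> A = 0\<close> form a net decreasing to \<open>0\<close>. If uo is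
  sequential, \<open>0\<close> belongs to the sequentially closed set of those \<open>x\<close> that dominate all lower bounds of
  some countable subset of \<open>A\<close>.
\<close>

section \<open>Order convergence versus \<sigma>-order convergence\<close>

lemma isGlb_UNIV_iff:
  "isGlb UNIV D g \<longleftrightarrow> (\<forall>d\<in>D. g \<le> d) \<and> (\<forall>w. (\<forall>d\<in>D. w \<le> d) \<longrightarrow> w \<le> g)"
  by (auto simp: isGlb_def greatestP_def isLb_def setge_def setle_def)

lemma sigma_o_conv_imp_o_conv: "\<sigma>o_conv I r x l \<Longrightarrow> o_conv I r x l"
  unfolding \<sigma>o_conv_def o_conv_def by blast

lemma unbounded_mono:
  assumes "\<And>z. conv I r z 0 \<Longrightarrow> conv' I r z 0" "unbounded conv I r x l"
  shows "unbounded conv' I r x l"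
  using assms unfolding unbounded_def by blast

text \<open>A countable subset of the dominating set \<open>D\<close> that still has infimum 0, once
  enumerated, is a dominating sequence.\<close>

lemma countable_sup_property_o_conv:
  fixes x :: "'i \<Rightarrow> 'a::vector_lattice"
  assumes csp: "countable_sup_property TYPE('a)" and o: "o_conv I r x l"
  shows "\<sigma>o_conv I r x l"
proof -
  from o obtain D where dir: "directed_preorder_on I r" and D: "isGlb UNIV D 0"
    and tail: "\<forall>d\<in>D. \<exists>\<alpha>\<^sub>d\<in>I. \<forall>\<alpha>\<in>I. (\<alpha>\<^sub>d, \<alpha>) \<in> r \<longrightarrow> \<bar>x \<alpha> - l\<bar> \<le> d"
    unfolding o_conv_def by blast
  from csp D obtain B where B: "B \<subseteq> D" "countable B" "isGlb UNIV B 0"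
    unfolding countable_sup_property_def by blast
  show ?thesis
  proof (cases "B = {}")
    \<comment> \<open>\<open>from_nat_into\<close> enumerates only nonempty sets. If the empty set
      has infimum 0, every element is at most 0, the space is trivial, and the constant sequence 0
      serves.\<close>
    case True
    with B(3) have nonpos: "w \<le> 0" for w :: 'a
      by (simp add: isGlb_UNIV_iff)
    obtain \<alpha>\<^sub>0 where "\<alpha>\<^sub>0 \<in> I"
      using dir unfolding directed_preorder_on_def by blast
    with dir nonpos show ?thesis
      unfolding \<sigma>o_conv_def
      by (intro conjI exI[of _ "\<lambda>_. 0"]) (auto simp: isGlb_UNIV_iff)
  next
    case False
    then have "range (from_nat_into B) = B"
      using B(2) by (simp add: range_from_nat_into)
    moreover have "from_nat_into B n \<in> B" for n
      using False by (rule from_nat_into)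
    ultimately show ?thesis
      unfolding \<sigma>o_conv_def using dir tail B(1,3)
      by (intro conjI exI[of _ "from_nat_into B"])
        (simp_all add: isGlb_UNIV_iff subset_iff)
  qed
qed

lemma countable_sup_property_uo_conv:
  assumes "countable_sup_property TYPE('a::vector_lattice)"
  shows "(uo_conv :: ('i, 'a) convergence) = u\<sigma>o_conv"
proof (intro ext iffI)
  fix I r l and x :: "'i \<Rightarrow> 'a"
  show "u\<sigma>o_conv I r x l" if "uo_conv I r x l"
    using that countable_sup_property_o_conv[OF assms]
    unfolding uo_conv_def u\<sigma>o_conv_def by (rule unbounded_mono[rotated])
  show "uo_conv I r x l" if "u\<sigma>o_conv I r x l"
    using that sigma_o_conv_imp_o_conv
    unfolding uo_conv_def u\<sigma>o_conv_def by (rule unbounded_mono[rotated])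
qed

section \<open>From the countable supremum property to the Frechet--Urysohn property\<close>

lemma directed_preorder_on_refl: "directed_preorder_on I r \<Longrightarrow> \<alpha> \<in> I \<Longrightarrow> (\<alpha>, \<alpha>) \<in> r"
  unfolding directed_preorder_on_def preorder_on_def by (blast dest: refl_onD)

lemma finite_subset_upper_bound:
  assumes dir: "directed_preorder_on I r" and "finite S" "S \<subseteq> I"
  shows "\<exists>\<gamma>\<in>I. \<forall>\<alpha>\<in>S. (\<alpha>, \<gamma>) \<in> r"
  using assms(2,3)
proof (induction S)
  case empty
  then show ?case
    using dir unfolding directed_preorder_on_def by blast
next
  case (insert \<alpha> S)
  then obtain \<beta> where \<beta>: "\<beta> \<in> I" "\<forall>\<alpha>'\<in>S. (\<alpha>', \<beta>) \<in> r"
    by blast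
  from insert.prems \<beta>(1) dir obtain \<gamma> where "\<gamma> \<in> I" "(\<alpha>, \<gamma>) \<in> r" "(\<beta>, \<gamma>) \<in> r"
    unfolding directed_preorder_on_def by blast
  with \<beta>(2) dir show ?case
    unfolding directed_preorder_on_def preorder_on_def by (blast dest: transD)
qed

text \<open>The Archimedean axiom in the form of an induction: if every multiple of \<open>w\<close>
  below \<open>y\<close> leaves room for one more copy of \<open>w\<close>, all multiples stay below
  \<open>y\<close>.\<close>

lemma archimedean_add_multiple:
  fixes w y :: "'a::archimedean_vector_lattice"
  assumes "0 \<le> w" and step: "\<And>n::nat. of_nat n *\<^sub>R w \<le> y \<Longrightarrow> of_nat n *\<^sub>R w + w \<le> y"
    and "0 \<le> y"
  shows "w = 0"
proof -
  have "of_nat n *\<^sub>R w \<le> y" for n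
  proof (induction n)
    case (Suc n)
    then show ?case
      using step[of n] by (simp add: scaleR_add_left add.commute)
  qed (use \<open>0 \<le> y\<close> in simp)
  then show ?thesis
    using archimedean \<open>0 \<le> w\<close> by (metis order.antisym)
qed

text \<open>Put v = \<open>inf w z\<close>. As v is below both \<open>w\<close> and
  \<open>z\<close>, it lies below the positive part of \<open>y\<close> - n v, which is
  \<open>y\<close> - n v itself while n v is below \<open>y\<close>. So one more copy of v fits
  below \<open>y\<close>.\<close>

lemma disjoint_of_le_pos_part_diff_multiples:
  fixes w y z :: "'a::archimedean_vector_lattice"
  assumes "0 \<le> w" "0 \<le> z" "w \<le> y" and le: "\<And>j::nat. w \<le> sup (y - of_nat j *\<^sub>R z) 0"
  shows "inf w z = 0"
proof (rule archimedean_add_multiple)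
  show "0 \<le> inf w z" "0 \<le> y"
    using assms by auto
  fix n :: nat
  assume n: "of_nat n *\<^sub>R inf w z \<le> y"
  have "inf w z \<le> w" by simp
  also have "\<dots> \<le> sup (y - of_nat n *\<^sub>R z) 0"
    by (rule le)
  also have "\<dots> \<le> sup (y - of_nat n *\<^sub>R inf w z) 0"
    by (intro sup_mono diff_left_mono scaleR_left_mono) auto
  also have "\<dots> = y - of_nat n *\<^sub>R inf w z"
    using n by (simp add: sup_absorb1)
  finally show "of_nat n *\<^sub>R inf w z + inf w z \<le> y"
    by (simp add: algebra_simps)
qed

text \<open>Exchanges the cut at \<open>y\<close> for a cut at \<open>p\<close>, at the price of the
  positive part of \<open>y - p\<close>. With c = \<open>inf y z\<close>, the identity c + p = sup c
  p + inf c p splits c into the positive part of c - p and \<open>inf c p\<close>; both are then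
  enlarged.\<close>

lemma inf_le_pos_part_diff_add_inf:
  fixes y z p :: "'a::vector_lattice"
  shows "inf y z \<le> sup (y - p) 0 + inf p z"
proof -
  have "sup (inf y z - p) 0 + p = sup (inf y z) p"
    using add_sup_distrib_right[of "inf y z - p" 0 p] by simp
  then have "inf y z + p = sup (inf y z - p) 0 + inf (inf y z) p + p"
    unfolding add_eq_inf_sup[of "inf y z" p] by (metis add.assoc add.commute)
  then have "inf y z = sup (inf y z - p) 0 + inf (inf y z) p"
    by (rule add_right_imp_eq)
  also have "\<dots> \<le> sup (y - p) 0 + inf p z"
    by (intro add_mono sup_mono diff_right_mono) (auto intro: le_infI1 le_infI2)
  finally show ?thesis .
qed

text \<open>Smallness is assumed only for cuts at multiples of the terms themselves, a countable
  family, yet the conclusion covers every cut \<open>y\<close>. A positive \<open>w\<close> below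
  all eventual bounds is disjoint from each \<open>z k\<close>, so subtracting \<open>w\<close> from
  a bound of all \<open>inf y (z n)\<close> leaves a bound. Repeating this puts every multiple of
  \<open>w\<close> below \<open>y\<close>.\<close>

lemma uo_null_sequence:
  fixes z :: "nat \<Rightarrow> 'a::archimedean_vector_lattice"
  assumes nonneg: "\<And>n. 0 \<le> z n" and "0 \<le> y"
    and mult: "\<And>j k. \<exists>u::nat \<Rightarrow> 'a. isGlb UNIV (range u) 0 \<and>
      (\<forall>m. \<forall>\<^sub>F n in sequentially. inf (of_nat j *\<^sub>R z k) (z n) \<le> u m)"
  shows "isGlb UNIV {d. \<forall>\<^sub>F n in sequentially. inf y (z n) \<le> d} 0"
proof -
  define D where "D = {d. \<forall>\<^sub>F n in sequentially. inf y (z n) \<le> d}"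
  have D_nonneg: "0 \<le> d" if d: "d \<in> D" for d
  proof -
    obtain n where "inf y (z n) \<le> d"
      using d unfolding D_def eventually_sequentially by blast
    moreover have "0 \<le> inf y (z n)"
      using nonneg \<open>0 \<le> y\<close> by simp
    ultimately show ?thesis by (rule order_trans[rotated])
  qed
  have lower: "w = 0" if "0 \<le> w" and w: "\<And>d. d \<in> D \<Longrightarrow> w \<le> d" for w
  proof -
    have "y \<in> D" by (simp add: D_def)
    then have "w \<le> y" by (rule w)
    have disj: "inf w (z k) = 0" for k
    proof (rule disjoint_of_le_pos_part_diff_multiples[where y = y])
      fix j :: nat
      let ?p = "of_nat j *\<^sub>R z k"
      obtain u :: "nat \<Rightarrow> 'a" where u: "isGlb UNIV (range u) 0"
        and ev: "\<And>m. \<forall>\<^sub>F n in sequentially. inf ?p (z n) \<le> u m"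
        using mult by blast
      \<comment> \<open>The cut at \<open>y\<close> is exchanged for the cut at \<open>?p\<close>,
        where \<open>u m\<close> is an eventual bound. The infimum over \<open>m\<close> then
        removes \<open>u m\<close>.\<close>
      have "w - sup (y - ?p) 0 \<le> u m" for m
      proof -
        have "sup (y - ?p) 0 + u m \<in> D"
          unfolding D_def using ev[of m]
          by (auto elim!: eventually_mono
              intro: order_trans[OF inf_le_pos_part_diff_add_inf[of y _ ?p]])
        from w[OF this] show ?thesis by (metis add.commute diff_le_eq)
      qed
      with u have "w - sup (y - ?p) 0 \<le> 0"
        unfolding isGlb_UNIV_iff by blast
      then show "w \<le> sup (y - ?p) 0"
        by (simp only: diff_le_0_iff_le)
    qed (use that nonneg \<open>w \<le> y\<close> in auto)
    have below: "of_nat j *\<^sub>R w \<le> y \<and> (\<forall>n. inf y (z n) \<le> y - of_nat j *\<^sub>R w)" for j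
    proof (induction j)
      case 0
      then show ?case using \<open>0 \<le> y\<close> by simp
    next
      case (Suc j)
      define y' where "y' = y - of_nat j *\<^sub>R w"
      have y': "inf y (z n) \<le> y'" for n
        using Suc by (simp add: y'_def)
      then have "w \<le> y'"
        by (intro w) (simp add: D_def)
      \<comment> \<open>The sum of disjoint elements is their supremum, and \<open>y'\<close>
        dominates both of them.\<close>
      have "inf y (z n) + w \<le> y'" for n
      proof -
        have "inf (inf y (z n)) w \<le> inf w (z n)"
          by (auto intro: le_infI1 le_infI2)
        with disj[of n] have "inf (inf y (z n)) w \<le> 0" by simp
        then have "inf y (z n) + w \<le> sup (inf y (z n)) w"
          by (simp add: add_eq_inf_sup[of "inf y (z n)" w])
        also have "\<dots> \<le> y'"
          using y' \<open>w \<le> y'\<close> by simp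
        finally show ?thesis .
      qed
      with \<open>w \<le> y'\<close> show ?case
        by (simp add: y'_def algebra_simps)
    qed
    show "w = 0"
    proof (rule archimedean_add_multiple[where y = y])
      fix j :: nat
      show "of_nat j *\<^sub>R w + w \<le> y"
        using conjunct1[OF below[of "Suc j"]] by (simp add: algebra_simps)
    qed fact+
  qed
  have "w \<le> 0" if "\<forall>d\<in>D. w \<le> d" for w
  proof -
    \<comment> \<open>Since \<open>D\<close> consists of positive elements, the positive part of a
      lower bound is again a lower bound.\<close>
    have "sup w 0 = 0"
      using that D_nonneg by (intro lower) auto
    then show ?thesis by (simp add: sup.order_iff sup_commute)
  qed
  with D_nonneg show ?thesis
    unfolding D_def[symmetric] isGlb_UNIV_iff by blast
qed

lemma directed_preorder_on_natLeq: "directed_preorder_on UNIV natLeq"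
  unfolding directed_preorder_on_def
proof (intro conjI ballI)
  show "preorder_on UNIV natLeq"
    using natLeq_Preorder by (simp add: Field_natLeq)
  show "\<exists>k\<in>UNIV. (m, k) \<in> natLeq \<and> (n, k) \<in> natLeq" for m n :: nat
    by (rule bexI[of _ "max m n"]) (auto simp: natLeq_def)
qed simp

text \<open>Passing to u\<sigma>o leaves countably many tail conditions for each cut. The cuts at
  multiples of chosen terms thus impose countably many conditions in all, which are met by
  diagonalisation, finitely many at each stage.\<close>

lemma countable_sup_property_frechet_urysohn:
  assumes csp: "countable_sup_property TYPE('a::archimedean_vector_lattice)"
  shows "frechet_urysohn (uo_conv :: ('i, 'a) convergence) uo_conv"
  unfolding frechet_urysohn_def
proof (intro allI impI, elim conjE)
  fix I r l and x :: "'i \<Rightarrow> 'a"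
  assume dir: "directed_preorder_on I r" and "uo_conv I r x l"
  then have conv: "u\<sigma>o_conv I r x l"
    using countable_sup_property_uo_conv[OF csp] by metis
  define z where "z \<alpha> = \<bar>l - x \<alpha>\<bar>" for \<alpha>
  have nonneg: "0 \<le> z \<alpha>" for \<alpha>
    by (simp add: z_def)
  have "\<exists>u a. isGlb UNIV (range u) 0 \<and>
      (\<forall>m::nat. a m \<in> I \<and> (\<forall>\<alpha>\<in>I. (a m, \<alpha>) \<in> r \<longrightarrow> inf y (z \<alpha>) \<le> u m))" if "0 \<le> y" for y
  proof -
    have "\<sigma>o_conv I r (\<lambda>\<alpha>. inf y (z \<alpha>)) 0"
      using conv that by (simp add: u\<sigma>o_conv_def unbounded_def z_def)
    moreover have "\<bar>inf y (z \<alpha>)\<bar> = inf y (z \<alpha>)" for \<alpha>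
      using that nonneg by (intro abs_of_nonneg) simp
    ultimately show ?thesis
      unfolding \<sigma>o_conv_def by (simp add: Bex_def) metis
  qed
  then obtain u a where u: "\<And>y. 0 \<le> y \<Longrightarrow> isGlb UNIV (range (u y)) 0"
    and a: "\<And>y m. 0 \<le> y \<Longrightarrow> a y m \<in> I"
    and ua: "\<And>y m \<alpha>. \<lbrakk>0 \<le> y; \<alpha> \<in> I; (a y m, \<alpha>) \<in> r\<rbrakk> \<Longrightarrow> inf y (z \<alpha>) \<le> u y (m::nat)"
    by metis
  \<comment> \<open>Stage \<open>n\<close> handles the triples \<open>(k, j, m)\<close> with entries
    below \<open>n\<close>. It refers only to earlier terms of \<open>f\<close>, and directedness
    satisfies it; a given triple is respected by every \<open>n\<close> beyond its maximum.\<close>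
  define P where "P f n \<beta> \<longleftrightarrow> \<beta> \<in> I \<and>
    (\<forall>k<n. \<forall>j<n. \<forall>m<n. (a (of_nat j *\<^sub>R z (f k)) m, \<beta>) \<in> r)" for f :: "nat \<Rightarrow> 'i" and n \<beta>
  have "\<exists>f. \<forall>n. P f n (f n)"
  proof (rule dependent_wellorder_choice)
    show "P f n \<beta> = P g n \<beta>" if "\<And>k. k < n \<Longrightarrow> f k = g k" for f g n \<beta>
      using that by (simp add: P_def)
    fix n f
    let ?S = "(\<lambda>(k, j, m). a (of_nat j *\<^sub>R z (f k)) m) ` ({..<n} \<times> {..<n} \<times> {..<n})"
    have "?S \<subseteq> I"
      by (auto intro!: a scaleR_nonneg_nonneg nonneg)
    from finite_subset_upper_bound[OF dir _ this]
    show "\<exists>\<beta>. P f n \<beta>"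
      by (force simp: P_def)
  qed
  then obtain \<alpha> where \<alpha>: "\<And>n. P \<alpha> n (\<alpha> n)"
    by blast
  then have "range \<alpha> \<subseteq> I"
    by (auto simp: P_def)
  have mult: "\<exists>u. isGlb UNIV (range u) 0 \<and>
      (\<forall>m. \<forall>\<^sub>F n in sequentially. inf (of_nat j *\<^sub>R z (\<alpha> k)) (z (\<alpha> n)) \<le> u (m::nat))" for j k
  proof (intro exI conjI allI)
    let ?y = "of_nat j *\<^sub>R z (\<alpha> k)"
    have y: "0 \<le> ?y"
      by (intro scaleR_nonneg_nonneg nonneg) simp
    then show "isGlb UNIV (range (u ?y)) 0"
      by (rule u)
    fix m
    show "\<forall>\<^sub>F n in sequentially. inf ?y (z (\<alpha> n)) \<le> u ?y m"
      using eventually_gt_at_top[of "max j (max k m)"]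
    proof eventually_elim
      case (elim n)
      with \<alpha>[of n] y show ?case
        by (intro ua) (auto simp: P_def)
    qed
  qed
  \<comment> \<open>The indices were chosen without reference to \<open>y\<close>, so one sequence
    serves all cuts.\<close>
  have "o_conv UNIV natLeq (\<lambda>n. inf y \<bar>l - x (\<alpha> n)\<bar>) 0" if "0 \<le> y" for y
    unfolding o_conv_def
  proof (intro conjI exI)
    show "isGlb UNIV {d. \<forall>\<^sub>F n in sequentially. inf y (z (\<alpha> n)) \<le> d} 0"
      using nonneg that mult by (rule uo_null_sequence)
    show "\<forall>d\<in>{d. \<forall>\<^sub>F n in sequentially. inf y (z (\<alpha> n)) \<le> d}.
      \<exists>N\<in>UNIV. \<forall>n\<in>UNIV. (N, n) \<in> natLeq \<longrightarrow> \<bar>inf y \<bar>l - x (\<alpha> n)\<bar> - 0\<bar> \<le> d"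
      using that by (simp add: eventually_sequentially natLeq_def z_def abs_of_nonneg)
  qed (rule directed_preorder_on_natLeq)
  then have "uo_conv UNIV natLeq (\<lambda>n. x (\<alpha> n)) l"
    by (simp add: uo_conv_def unbounded_def)
  with \<open>range \<alpha> \<subseteq> I\<close>
  show "\<exists>\<alpha>. range \<alpha> \<subseteq> I \<and> uo_conv UNIV natLeq (\<lambda>n. x (\<alpha> n)) l"
    by blast
qed

lemma frechet_urysohn_imp_sequential:
  assumes "frechet_urysohn conv conv_seq"
  shows "sequential_convergence conv conv_seq"
  unfolding sequential_convergence_def closed_under_def
proof (intro allI impI, elim conjE)
  fix C I r x l
  assume C: "sequentially_closed_under conv_seq C"
    and net: "directed_preorder_on I r" "x ` I \<subseteq> C" "conv I r x l"
  from assms net(1,3) obtain \<alpha> :: "nat \<Rightarrow> 'a"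
    where "range \<alpha> \<subseteq> I" "conv_seq UNIV natLeq (\<lambda>n. x (\<alpha> n)) l"
    unfolding frechet_urysohn_def by blast
  moreover from this net(2) have "range (\<lambda>n. x (\<alpha> n)) \<subseteq> C"
    by auto
  ultimately show "l \<in> C"
    using C unfolding sequentially_closed_under_def by blast
qed

section \<open>Nets of finite infima and the converse implications\<close>

definition finite_infs :: "'a::lattice set \<Rightarrow> 'a set" where
  "finite_infs A = {Inf_fin F |F. finite F \<and> F \<noteq> {} \<and> F \<subseteq> A}"

lemma subset_finite_infs: "A \<subseteq> finite_infs A"
proof
  fix a assume "a \<in> A"
  then show "a \<in> finite_infs A"
    unfolding finite_infs_def by (intro CollectI exI[of _ "{a}"]) simp
qed

lemma finite_infs_inf:
  assumes "a \<in> finite_infs A" "b \<in> finite_infs A"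
  shows "inf a b \<in> finite_infs A"
proof -
  from assms obtain F G where "finite F" "F \<noteq> {}" "F \<subseteq> A" "a = Inf_fin F"
    and "finite G" "G \<noteq> {}" "G \<subseteq> A" "b = Inf_fin G"
    unfolding finite_infs_def by blast
  then show ?thesis
    unfolding finite_infs_def
    by (intro CollectI exI[of _ "F \<union> G"]) (simp add: Inf_fin.union)
qed

lemma isGlb_finite_infs:
  assumes "isGlb UNIV A g"
  shows "isGlb UNIV (finite_infs A) g"
  unfolding isGlb_UNIV_iff
proof (intro conjI ballI allI impI)
  fix d assume "d \<in> finite_infs A"
  with assms show "g \<le> d"
    by (auto simp: finite_infs_def isGlb_UNIV_iff intro!: Inf_fin.boundedI)
next
  fix w assume "\<forall>d\<in>finite_infs A. w \<le> d"
  then show "w \<le> g"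
    using assms subset_finite_infs[of A] unfolding isGlb_UNIV_iff by blast
qed

text \<open>Closing \<open>A\<close> under finite infima makes it directed downwards and keeps its
  infimum. The closure, ordered by reversed \<le> and copied into \<open>'i\<close> by an injection,
  indexes itself. It also serves as its own dominating set, since the net is below \<open>d\<close>
  from the index of \<open>d\<close> on.\<close>

lemma finite_infs_net:
  fixes A :: "'a::vector_lattice set"
  assumes inj: "(UNIV :: 'a set) \<lesssim> (UNIV :: 'i set)" and A: "A \<noteq> {}" "isGlb UNIV A 0"
  obtains I :: "'i set" and r x where "directed_preorder_on I r" "x ` I = finite_infs A" "uo_conv I r x 0"
proof -
  obtain f :: "'a \<Rightarrow> 'i" where f: "inj f"
    using inj unfolding lepoll_def by blast
  define M where "M = finite_infs A"
  define r where "r = {(f a, f b) |a b. a \<in> M \<and> b \<in> M \<and> b \<le> a}"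
  have r_iff: "(f a, f b) \<in> r \<longleftrightarrow> a \<in> M \<and> b \<in> M \<and> b \<le> a" for a b
    using f by (auto simp: r_def inj_eq)
  have M: "isGlb UNIV M 0"
    unfolding M_def using A(2) by (rule isGlb_finite_infs)
  have dir: "directed_preorder_on (f ` M) r"
    unfolding directed_preorder_on_def preorder_on_def
  proof (intro conjI ballI)
    show "f ` M \<noteq> {}"
      using A(1) subset_finite_infs[of A] by (auto simp: M_def)
    show "r \<subseteq> f ` M \<times> f ` M"
      by (auto simp: r_def)
    show "refl_on (f ` M) r"
      by (auto simp: refl_on_def r_iff)
    show "trans r"
    proof (rule transI)
      fix p q s assume "(p, q) \<in> r" "(q, s) \<in> r"
      then show "(p, s) \<in> r"
        using f by (auto simp: r_def inj_eq intro: order_trans)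
    qed
    fix \<alpha> \<beta> assume "\<alpha> \<in> f ` M" "\<beta> \<in> f ` M"
    then obtain a b where ab: "a \<in> M" "b \<in> M" "\<alpha> = f a" "\<beta> = f b"
      by blast
    moreover from ab have "inf a b \<in> M"
      unfolding M_def by (simp add: finite_infs_inf)
    ultimately show "\<exists>\<gamma>\<in>f ` M. (\<alpha>, \<gamma>) \<in> r \<and> (\<beta>, \<gamma>) \<in> r"
      by (intro bexI[of _ "f (inf a b)"]) (auto simp: r_iff)
  qed
  moreover have "inv f ` f ` M = finite_infs A"
    using f by (simp add: image_inv_f_f M_def)
  moreover have "uo_conv (f ` M) r (inv f) 0"
    unfolding uo_conv_def unbounded_def o_conv_def
  proof (intro allI impI conjI exI)
    fix y :: 'a assume "0 \<le> y"
    have "\<bar>inf y \<bar>0 - b\<bar> - 0\<bar> \<le> d" if "b \<in> M" "b \<le> d" for b d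
    proof -
      have "0 \<le> b"
        using M that(1) by (simp add: isGlb_UNIV_iff)
      with \<open>0 \<le> y\<close> have "\<bar>inf y \<bar>0 - b\<bar> - 0\<bar> = inf y b"
        by (simp add: abs_of_nonneg)
      with that(2) show ?thesis
        by (simp add: le_infI2)
    qed
    then show "\<forall>d\<in>M. \<exists>\<alpha>\<^sub>d\<in>f ` M. \<forall>\<alpha>\<in>f ` M. (\<alpha>\<^sub>d, \<alpha>) \<in> r \<longrightarrow> \<bar>inf y \<bar>0 - inv f \<alpha>\<bar> - 0\<bar> \<le> d"
      using f by (auto simp: r_iff inv_f_f)
  qed (rule dir M)+
  ultimately show thesis
    by (rule that)
qed

text \<open>Each term \<open>u n\<close> dominates some element of the net cut at \<open>y\<close>,
  hence \<open>inf y (Inf_fin F)\<close> for a finite \<open>F\<close> inside \<open>A\<close>. The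
  union of these finite sets, together with \<open>y\<close>, is the countable subset.\<close>

lemma uo_eq_u\<sigma>o_imp_countable_sup_property:
  assumes inj: "(UNIV :: 'a::archimedean_vector_lattice set) \<lesssim> (UNIV :: 'i set)"
    and eq: "(uo_conv :: ('i, 'a) convergence) = u\<sigma>o_conv"
  shows "countable_sup_property TYPE('a)"
  unfolding countable_sup_property_def
proof (intro allI impI)
  fix A :: "'a set" assume A: "isGlb UNIV A 0"
  show "\<exists>B\<subseteq>A. countable B \<and> isGlb UNIV B 0"
  \<comment> \<open>The net needs a nonempty index set; an empty \<open>A\<close> is its own
    countable subset.\<close>
  proof (cases "A = {}")
    case True
    with A show ?thesis by auto
  next
    case False
    \<comment> \<open>The cut is taken from \<open>A\<close>, so that \<open>y\<close> can join
      \<open>B\<close> and lower bounds of \<open>B\<close> survive the cut.\<close>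
    then obtain y where "y \<in> A" by blast
    with A have "0 \<le> y" by (simp add: isGlb_UNIV_iff)
    obtain I :: "'i set" and r x
      where net: "directed_preorder_on I r" "x ` I = finite_infs A" "uo_conv I r x 0"
      using finite_infs_net[OF inj False A] by blast
    have "\<sigma>o_conv I r (\<lambda>\<alpha>. inf y \<bar>0 - x \<alpha>\<bar>) 0"
      using net(3) \<open>0 \<le> y\<close> unfolding eq u\<sigma>o_conv_def unbounded_def by blast
    then obtain u :: "nat \<Rightarrow> 'a" where u: "isGlb UNIV (range u) 0"
      and ev: "\<And>n. \<exists>\<alpha>\<^sub>n\<in>I. \<forall>\<alpha>\<in>I. (\<alpha>\<^sub>n, \<alpha>) \<in> r \<longrightarrow> \<bar>inf y \<bar>0 - x \<alpha>\<bar> - 0\<bar> \<le> u n"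
      unfolding \<sigma>o_conv_def by blast
    have "\<exists>F. finite F \<and> F \<noteq> {} \<and> F \<subseteq> A \<and> inf y (Inf_fin F) \<le> u n" for n
    proof -
      obtain \<alpha> where \<alpha>: "\<alpha> \<in> I" "\<bar>inf y \<bar>0 - x \<alpha>\<bar> - 0\<bar> \<le> u n"
        using ev[of n] directed_preorder_on_refl[OF net(1)] by blast
      with net(2) have "x \<alpha> \<in> finite_infs A" by blast
      moreover have "inf y (x \<alpha>) \<le> \<bar>inf y \<bar>0 - x \<alpha>\<bar> - 0\<bar>"
      proof -
        have "inf y (x \<alpha>) \<le> inf y \<bar>0 - x \<alpha>\<bar>"
          by (intro inf_mono) (simp_all add: abs_ge_self)
        also have "\<dots> \<le> \<bar>inf y \<bar>0 - x \<alpha>\<bar> - 0\<bar>"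
          by (metis abs_ge_self diff_zero)
        finally show ?thesis .
      qed
      ultimately show ?thesis
        using \<alpha>(2) unfolding finite_infs_def by (auto intro: order_trans)
    qed
    then obtain F where F: "\<And>n. finite (F n)" "\<And>n. F n \<noteq> {}" "\<And>n. F n \<subseteq> A"
      "\<And>n. inf y (Inf_fin (F n)) \<le> u n"
      by metis
    define B where "B = insert y (\<Union>n. F n)"
    have "B \<subseteq> A" "countable B"
      using \<open>y \<in> A\<close> F(1,3) by (auto simp: B_def intro: countable_finite)
    moreover have "isGlb UNIV B 0"
      unfolding isGlb_UNIV_iff
    proof (intro conjI allI impI)
      show "\<forall>b\<in>B. 0 \<le> b"
        using \<open>B \<subseteq> A\<close> A by (auto simp: isGlb_UNIV_iff)
      fix w assume w: "\<forall>b\<in>B. w \<le> b"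
      have "w \<le> u n" for n
      proof -
        have "w \<le> inf y (Inf_fin (F n))"
          using w F(1,2) by (auto simp: B_def intro!: Inf_fin.boundedI)
        also have "\<dots> \<le> u n" by (rule F(4))
        finally show ?thesis .
      qed
      with u show "w \<le> 0" by (auto simp: isGlb_UNIV_iff)
    qed
    ultimately show ?thesis by blast
  qed
qed

text \<open>Cut at the positive part \<open>y\<close> of \<open>w - l\<close>. It lies below every
  \<open>\<bar>l - x \<alpha>\<bar>\<close>, so the cut net is constantly \<open>y\<close>, and a
  constant net tending to 0 is 0.\<close>

lemma uo_conv_lower_bound:
  fixes x :: "'i \<Rightarrow> 'a::vector_lattice"
  assumes conv: "uo_conv I r x l" and w: "\<And>\<alpha>. \<alpha> \<in> I \<Longrightarrow> w \<le> x \<alpha>"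
  shows "w \<le> l"
proof -
  define y where "y = sup (w - l) 0"
  have "0 \<le> y" by (simp add: y_def)
  then obtain D where dir: "directed_preorder_on I r" and D: "isGlb UNIV D 0"
    and tail: "\<forall>d\<in>D. \<exists>\<alpha>\<^sub>d\<in>I. \<forall>\<alpha>\<in>I. (\<alpha>\<^sub>d, \<alpha>) \<in> r \<longrightarrow> \<bar>inf y \<bar>l - x \<alpha>\<bar> - 0\<bar> \<le> d"
    using conv unfolding uo_conv_def unbounded_def o_conv_def by blast
  have y: "\<bar>inf y \<bar>l - x \<alpha>\<bar> - 0\<bar> = y" if "\<alpha> \<in> I" for \<alpha>
  proof -
    have "w - l \<le> x \<alpha> - l"
      using w[OF that] by simp
    also have "\<dots> \<le> \<bar>l - x \<alpha>\<bar>"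
      by (metis abs_ge_self abs_minus_commute)
    finally have "y \<le> \<bar>l - x \<alpha>\<bar>" by (simp add: y_def)
    with \<open>0 \<le> y\<close> show ?thesis by (simp add: inf_absorb1)
  qed
  have "y \<le> d" if d: "d \<in> D" for d
  proof -
    obtain \<alpha> where "\<alpha> \<in> I" "\<bar>inf y \<bar>l - x \<alpha>\<bar> - 0\<bar> \<le> d"
      using tail d directed_preorder_on_refl[OF dir] by blast
    then show ?thesis using y by simp
  qed
  with D have "y \<le> 0" by (simp add: isGlb_UNIV_iff)
  then show ?thesis by (simp add: y_def)
qed

lemma sequential_imp_countable_sup_property:
  assumes inj: "(UNIV :: 'a::archimedean_vector_lattice set) \<lesssim> (UNIV :: 'i set)"
    and seq: "sequential_convergence (uo_conv :: ('i, 'a) convergence) uo_conv"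
  shows "countable_sup_property TYPE('a)"
  unfolding countable_sup_property_def
proof (intro allI impI)
  fix A :: "'a set" assume A: "isGlb UNIV A 0"
  show "\<exists>B\<subseteq>A. countable B \<and> isGlb UNIV B 0"
  proof (cases "A = {}")
    case True
    with A show ?thesis by auto
  next
    case False
    obtain I :: "'i set" and r x
      where net: "directed_preorder_on I r" "x ` I = finite_infs A" "uo_conv I r x 0"
      using finite_infs_net[OF inj False A] by blast
    \<comment> \<open>Members of \<open>C\<close> need not be infima: dominating all lower bounds of
      a countable set is a condition that survives sequential limits, with the union of the
      countable witnesses as the new witness. For the element 0 it is what the countable supremum
      property asks.\<close>
    define C where "C = {c. \<exists>B\<subseteq>A. countable B \<and> (\<forall>w. (\<forall>b\<in>B. w \<le> b) \<longrightarrow> w \<le> c)}"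
    have "sequentially_closed_under uo_conv C"
      unfolding sequentially_closed_under_def
    proof (intro allI impI, elim conjE)
      fix s :: "nat \<Rightarrow> 'a" and l
      assume "range s \<subseteq> C" and conv: "uo_conv UNIV natLeq s l"
      then have "\<forall>n. \<exists>B\<subseteq>A. countable B \<and> (\<forall>w. (\<forall>b\<in>B. w \<le> b) \<longrightarrow> w \<le> s n)"
        by (auto simp: C_def)
      then obtain B where B: "\<And>n. B n \<subseteq> A" "\<And>n. countable (B n)"
        "\<And>n w. \<forall>b\<in>B n. w \<le> b \<Longrightarrow> w \<le> s n"
        by metis
      have "w \<le> l" if "\<forall>b\<in>\<Union>n. B n. w \<le> b" for w
        using that by (intro uo_conv_lower_bound[OF conv] B(3)) blast
      with B(1,2) show "l \<in> C"
        unfolding C_def by (intro CollectI exI[of _ "\<Union>n. B n"]) auto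
    qed
    then have "closed_under (uo_conv :: ('i, 'a) convergence) C"
      using seq unfolding sequential_convergence_def by blast
    moreover have "finite_infs A \<subseteq> C"
    proof
      fix c assume "c \<in> finite_infs A"
      then obtain F where "finite F" "F \<noteq> {}" "F \<subseteq> A" "c = Inf_fin F"
        unfolding finite_infs_def by blast
      then show "c \<in> C"
        unfolding C_def
        by (intro CollectI exI[of _ F]) (auto intro: countable_finite Inf_fin.boundedI)
    qed
    ultimately have "0 \<in> C"
      using net unfolding closed_under_def by blast
    then obtain B where "B \<subseteq> A" "countable B" "\<forall>w. (\<forall>b\<in>B. w \<le> b) \<longrightarrow> w \<le> 0"
      unfolding C_def by blast
    moreover from this A have "isGlb UNIV B 0"
      by (auto simp: isGlb_UNIV_iff)
    ultimately show ?thesis by blast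
  qed
qed

(* All nets have index sets in the type 'i. It is arbitrary, except that it must be able to hold
   an index set of the size of X; without such a bound there could be too few nets for (ii)-(iv). *)
theorem proposition4p37:
  assumes "(UNIV :: 'a::archimedean_vector_lattice set) \<lesssim> (UNIV :: 'i set)"
  shows "(countable_sup_property TYPE('a) \<longleftrightarrow>
            (uo_conv :: ('i, 'a) convergence) = u\<sigma>o_conv) \<and>
         (countable_sup_property TYPE('a) \<longleftrightarrow>
            frechet_urysohn (uo_conv :: ('i, 'a) convergence) uo_conv) \<and>
         (countable_sup_property TYPE('a) \<longleftrightarrow>
            sequential_convergence (uo_conv :: ('i, 'a) convergence) uo_conv)"
  using countable_sup_property_uo_conv uo_eq_u\<sigma>o_imp_countable_sup_property[OF assms]
    countable_sup_property_frechet_urysohn frechet_urysohn_imp_sequential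
    sequential_imp_countable_sup_property[OF assms]
  by blast

end
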